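(* Let $I=(k,n,d,X,\Omega,\kappa^{\pm})$ be an instance and let $S=\{s_1,\dots,s_k\}\subset\mathbb{R}^d$ be initial sites. Then the number of iterations of the weight-balanced $k$-means algorithm (described in the context), run on $(I,S)$, is bounded by $$(40\,e\,k^2 n)^{(d+1)k-1},$$ where $e$ is the Euler number.
   Context: Instance: $k,n,d\in\mathbb{N}$ with $n\ge k\ge 2$; $X=\{x_1,\dots,x_n\}\subset\mathbb{R}^d$ is a set of $n$ distinct points whose affine hull has dimension $d$ (so $d+1\le n$); weights $\Omega=(\omega_1,\dots,\omega_n)$ with all $\omega_j>0$; $\kappa^-=(\kappa_1^-,\dots,\kappa_k^-)$, $\kappa^+=(\kappa_1^+,\dots,\kappa_k^+)\in\mathbb{R}^k$ with $0<\kappa_i^-\le\kappa_i^+$ for all $i$ and $\sum_{i=1}^k\kappa_i^-\le\sum_{j=1}^n\omega_j\le\sum_{i=1}^k\kappa_i^+$. Clusterings: a (partial membership) $k$-clustering $C=(C_1,\dots,C_k)$ of $X$ is given by an assignment vector $y=(y_{ij})\in[0,1]^{kn}$ with $\sum_{i=1}^k y_{ij}=1$ for all $j\le n$; $C_i=(y_{i1},\dots,y_{in})$. The size of $C_i$ is $|C_i|=\sum_{j=1}^n y_{ij}\omega_j$, and its center of gravity is $c_i=\frac{1}{|C_i|}\sum_{j=1}^n y_{ij}\omega_j x_j$. Weight-balanced $k$-means algorithm, started with sites $S=S^{(1)}$. In iteration $l=1,2,\dots$: (1) For the current sites $S^{(l)}=\{s_1,\dots,s_k\}$, compute a basic feasible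 optimal solution (a vertex of the feasible polytope at which the minimum is attained) of the linear program: minimize $\sum_{i=1}^k\sum_{j=1}^n y_{ij}\omega_j(s_i^Ts_i-2x_j^Ts_i)$ subject to $\kappa_i^-\le\sum_{j=1}^n y_{ij}\omega_j\le\kappa_i^+$ $(i\le k)$, $\sum_{i=1}^k y_{ij}=1$ $(j\le n)$, $y_{ij}\ge0$ $(i\le k,\ j\le n)$. Let $C^{(l)}$ be the clustering given by this solution. (2) Update each site $s_i$ to the center of gravity of the $i$-th cluster of $C^{(l)}$; this gives $S^{(l+1)}$. If the objective function value decreased during the iteration, i.e. $\Theta(C^{(l)},S^{(l+1)})<\Theta(C^{(l)},S^{(l)})$ where $\Theta(C,S)=\sum_{i=1}^k\sum_{j=1}^n y_{ij}\omega_j(s_i^Ts_i-2x_j^Ts_i)$, go to (1) with $S^{(l+1)}$; otherwise return the current clustering $C^{(l)}$ and sites $S^{(l+1)}$. Standing assumption: all sites $s_1,\dots,s_k$ are pairwise different (also the sites arising in the course of the algorithm). *)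

theory Defs
  imports "HOL-Analysis.Analysis" "HOL-Library.Extended_Nat"
begin

text \<open>
  The numbers k, n and d are the cardinalities of the finite index types \<open>'k\<close> (clusters),
  \<open>'n\<close> (points) and \<open>'d\<close> (coordinates).  A clustering is given by its assignment vector
  \<open>y :: real ^ 'n ^ 'k\<close>, where \<open>y $ i $ j\<close> is the fraction of point j assigned to cluster i.
  As \<open>real ^ 'n ^ 'k\<close> is the Euclidean space of dimension kn, vertices of the feasible polytope
  are its extreme points in the sense of the library.
\<close>

definition kmeans_instance ::
  "('n::finite \<Rightarrow> real ^ 'd) \<Rightarrow> ('n \<Rightarrow> real) \<Rightarrow> ('k::finite \<Rightarrow> real) \<Rightarrow> ('k \<Rightarrow> real) \<Rightarrow> bool"
where
  "kmeans_instance x \<omega> \<kappa>m \<kappa>p \<longleftrightarrow>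
     2 \<le> CARD('k) \<and> CARD('k) \<le> CARD('n) \<and>
     inj x \<and> aff_dim (affine hull (range x)) = int CARD('d) \<and>
     (\<forall>j. 0 < \<omega> j) \<and>
     (\<forall>i. 0 < \<kappa>m i \<and> \<kappa>m i \<le> \<kappa>p i) \<and>
     (\<Sum>i\<in>UNIV. \<kappa>m i) \<le> (\<Sum>j\<in>UNIV. \<omega> j) \<and>
     (\<Sum>j\<in>UNIV. \<omega> j) \<le> (\<Sum>i\<in>UNIV. \<kappa>p i)"

definition cluster_size :: "('n::finite \<Rightarrow> real) \<Rightarrow> real ^ 'n ^ 'k \<Rightarrow> 'k \<Rightarrow> real" where
  "cluster_size \<omega> y i = (\<Sum>j\<in>UNIV. y $ i $ j * \<omega> j)"

definition center_of_gravity ::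
  "('n::finite \<Rightarrow> real ^ 'd) \<Rightarrow> ('n \<Rightarrow> real) \<Rightarrow> real ^ 'n ^ 'k \<Rightarrow> 'k \<Rightarrow> real ^ 'd"
where
  "center_of_gravity x \<omega> y i =
     (1 / cluster_size \<omega> y i) *\<^sub>R (\<Sum>j\<in>UNIV. (y $ i $ j * \<omega> j) *\<^sub>R x j)"

definition objective ::
  "('n::finite \<Rightarrow> real ^ 'd) \<Rightarrow> ('n \<Rightarrow> real) \<Rightarrow> real ^ 'n ^ 'k::finite \<Rightarrow> ('k \<Rightarrow> real ^ 'd) \<Rightarrow> real"
where
  "objective x \<omega> y s =
     (\<Sum>i\<in>UNIV. \<Sum>j\<in>UNIV. y $ i $ j * \<omega> j * (s i \<bullet> s i - 2 * (x j \<bullet> s i)))"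

definition feasible_polytope ::
  "('n::finite \<Rightarrow> real) \<Rightarrow> ('k::finite \<Rightarrow> real) \<Rightarrow> ('k \<Rightarrow> real) \<Rightarrow> (real ^ 'n ^ 'k) set"
where
  "feasible_polytope \<omega> \<kappa>m \<kappa>p =
     {y. (\<forall>i. \<kappa>m i \<le> cluster_size \<omega> y i \<and> cluster_size \<omega> y i \<le> \<kappa>p i) \<and>
         (\<forall>j. (\<Sum>i\<in>UNIV. y $ i $ j) = 1) \<and>
         (\<forall>i j. 0 \<le> y $ i $ j)}"

definition basic_optimal_solution ::
  "('n::finite \<Rightarrow> real ^ 'd) \<Rightarrow> ('n \<Rightarrow> real) \<Rightarrow> ('k::finite \<Rightarrow> real) \<Rightarrow> ('k \<Rightarrow> real) \<Rightarrow>
   ('k \<Rightarrow> real ^ 'd) \<Rightarrow> real ^ 'n ^ 'k \<Rightarrow> bool"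
where
  "basic_optimal_solution x \<omega> \<kappa>m \<kappa>p s y \<longleftrightarrow>
     y extreme_point_of feasible_polytope \<omega> \<kappa>m \<kappa>p \<and>
     (\<forall>z \<in> feasible_polytope \<omega> \<kappa>m \<kappa>p. objective x \<omega> y s \<le> objective x \<omega> z s)"

text \<open>
  A complete execution with initial sites \<open>S0\<close> that performs exactly \<open>T\<close> iterations, where
  \<open>T = \<infinity>\<close> means that the algorithm does not terminate.  Iteration \<open>l\<close> (starting from 1) uses the
  sites \<open>S l\<close>, computes the clustering \<open>C l\<close> and the new sites \<open>S (l + 1)\<close>, and is followed by
  another iteration iff the objective value decreased; values of \<open>C\<close> and \<open>S\<close> at other indices are
  irrelevant.  The optimal vertex is not unique in general, so that there may be several
  executions from the same initial sites.
\<close>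

definition kmeans_execution ::
  "('n::finite \<Rightarrow> real ^ 'd) \<Rightarrow> ('n \<Rightarrow> real) \<Rightarrow> ('k::finite \<Rightarrow> real) \<Rightarrow> ('k \<Rightarrow> real) \<Rightarrow>
   ('k \<Rightarrow> real ^ 'd) \<Rightarrow> enat \<Rightarrow> (nat \<Rightarrow> real ^ 'n ^ 'k) \<Rightarrow> (nat \<Rightarrow> 'k \<Rightarrow> real ^ 'd) \<Rightarrow> bool"
where
  "kmeans_execution x \<omega> \<kappa>m \<kappa>p S0 T C S \<longleftrightarrow>
     1 \<le> T \<and> S 1 = S0 \<and>
     (\<forall>l. 1 \<le> l \<and> enat l \<le> T \<longrightarrow>
        basic_optimal_solution x \<omega> \<kappa>m \<kappa>p (S l) (C l) \<and>
        S (l + 1) = center_of_gravity x \<omega> (C l) \<and>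
        (enat l < T \<longleftrightarrow> objective x \<omega> (C l) (S (l + 1)) < objective x \<omega> (C l) (S l)))"

end

theory Submission
  imports Defs
begin

text \<open>
  Fix an iteration with sites \<open>s\<close> and clustering \<open>y\<close>.  By linear programming duality, optimality of
  \<open>y\<close> for \<open>s\<close> is witnessed by one multiplier \<open>\<mu> i\<close> per cluster: if \<open>\<mu> i\<close> is positive (negative), then
  cluster i has its smallest (largest) admissible size, and the point \<open>x j\<close> belongs only to clusters i
  that minimise \<open>s i \<bullet> s i - 2 * (x j \<bullet> s i) - \<mu> i\<close>; that is, \<open>y\<close> is compatible with a power diagram.
  Whether a fixed \<open>y\<close> satisfies these conditions depends only on a \<^emph>\<open>signature\<close> of \<open>(s, \<mu>)\<close>: the
  signs of all \<open>\<mu> i\<close> and the signs of all differences of two such expressions.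

  Two facts give the bound.

  \<^item> A signature occurs at most in two consecutive iterations.  If it occurs in the iterations
    \<open>l\<close> and \<open>m\<close> with \<open>l + 2 \<le> m\<close>, then \<open>C l\<close> is also optimal for the sites \<open>S m\<close>
    (\<open>cluster_multipliers_cong\<close>, \<open>optimal_if_cluster_multipliers\<close>), so the optimal value of iteration
    \<open>m\<close> is the objective of \<open>C l\<close> at \<open>S m\<close>.  As \<open>S (l + 1)\<close> are the best sites for \<open>C l\<close>, this is at
    least the objective of \<open>C l\<close> at \<open>S (l + 1)\<close>, hence at least the optimal value of iteration
    \<open>l + 1\<close>.  This contradicts the strict decrease between the iterations \<open>l + 1\<close> and \<open>m\<close>.

  \<^item> There are few signatures.  With \<open>b i = s i \<bullet> s i - \<mu> i\<close> as a new variable in place of \<open>\<mu> i\<close>, the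
    differences become linear forms in \<open>(s, b)\<close>, a vector with \<open>(d + 1) k\<close> coordinates, and they do not
    change if one constant is added to all \<open>b i\<close>.  So one coordinate may be taken to be 0.
    At most \<open>n k\<^sup>2\<close> linear forms on a space of dimension \<open>(d + 1) k - 1\<close> have at most
    \<open>(2 n k\<^sup>2 + 1) ^ ((d + 1) k - 1)\<close> sign vectors (\<open>card_sign_vectors_le\<close>).  The signs of the \<open>\<mu> i\<close>,
    which are quadratic in \<open>(s, b)\<close>, are counted separately and contribute a factor \<open>3 ^ k\<close>.

  The resulting bound \<open>2 * 3 ^ k * (2 n k\<^sup>2 + 1) ^ ((d + 1) k - 1)\<close> is below the claimed one because
  \<open>(d + 1) k - 1 \<ge> k + 1\<close>.
\<close>

section \<open>Sign vectors of linear forms\<close>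

definition sign_vector :: "('i \<Rightarrow> 'a \<Rightarrow> real) \<Rightarrow> 'i set \<Rightarrow> 'a \<Rightarrow> 'i \<Rightarrow> real" where
  "sign_vector f I v = (\<lambda>i. if i \<in> I then sgn (f i v) else 0)"

lemma sign_vector_eqD:
  "sign_vector f I u = sign_vector f I v \<Longrightarrow> i \<in> I \<Longrightarrow> sgn (f i u) = sgn (f i v)"
  unfolding sign_vector_def by (metis (full_types))

lemma sign_vector_insert:
  "sign_vector f (insert h I) v = (sign_vector f I v)(h := sgn (f h v))"
  by (auto simp: sign_vector_def fun_eq_iff)

lemma sgn_pos_combination:
  fixes a b p q :: real
  assumes "sgn a = sgn b" "p > 0" "q > 0"
  shows "sgn (p * a + q * b) = sgn a"
proof (cases a "0::real" rule: linorder_cases)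
  case less
  then have "b < 0" using assms(1) by (metis sgn_1_neg sgn_neg)
  then have "p * a + q * b < 0" using less assms by (intro add_neg_neg mult_pos_neg)
  then show ?thesis using less by simp
next
  case equal
  then show ?thesis using assms(1) by (simp add: sgn_0_0)
next
  case greater
  then have "b > 0" using assms(1) by (metis sgn_1_pos sgn_pos)
  then have "p * a + q * b > 0" using greater assms by (intro add_pos_pos mult_pos_pos)
  then show ?thesis using greater by simp
qed

text \<open>
  The induction adds one form h at a time.  A sign vector of the other forms splits only if it occurs
  on both sides of the hyperplane \<open>f h = 0\<close>, and then, by convexity of the set of points with that
  sign vector, it also occurs on the hyperplane.  The sign vectors that split are therefore sign
  vectors on a space of smaller dimension, and each of them splits into three.
\<close>

lemma card_sign_vectors_le:
  fixes f :: "'i \<Rightarrow> 'a::euclidean_space \<Rightarrow> real"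
  assumes "finite I" "\<And>i. i \<in> I \<Longrightarrow> linear (f i)" "subspace U"
  shows "finite (sign_vector f I ` U) \<and> card (sign_vector f I ` U) \<le> (2 * card I + 1) ^ dim U"
  using assms
proof (induction I arbitrary: U rule: finite_induct)
  case empty
  have sub: "sign_vector f {} ` U \<subseteq> {\<lambda>_. 0}" by (auto simp: sign_vector_def)
  have "finite {\<lambda>_ :: 'i. 0 :: real}" "card {\<lambda>_ :: 'i. 0 :: real} = 1" by simp_all
  then show ?case using card_mono[OF _ sub] finite_subset[OF sub] by simp
next
  case (insert h I)
  have lin: "linear (f h)" and linI: "\<And>i. i \<in> I \<Longrightarrow> linear (f i)" using insert.prems by auto
  define F where "F = sign_vector f I ` U"
  have F: "finite F" "card F \<le> (2 * card I + 1) ^ dim U"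
    using insert.IH[OF linI \<open>subspace U\<close>] by (auto simp: F_def)
  define H where "H = {v \<in> U. f h v = 0}"
  have subH: "subspace H"
    using \<open>subspace U\<close> lin
    by (auto simp: subspace_def H_def linear_0 linear_add linear_scale)
  define F0 where "F0 = sign_vector f I ` H"
  have F0: "finite F0" "card F0 \<le> (2 * card I + 1) ^ dim H"
    using insert.IH[OF linI subH] by (auto simp: F0_def)
  show ?case
  proof (cases "H = U")
    case True
    have "f h v = 0" if "v \<in> U" for v using that True H_def by blast
    then have "sign_vector f (insert h I) ` U = (\<lambda>t. t(h := 0)) ` F"
      unfolding F_def image_image by (intro image_cong) (simp_all add: sign_vector_insert)
    then have "finite (sign_vector f (insert h I) ` U)"
      "card (sign_vector f (insert h I) ` U) \<le> card F"
      using F card_image_le by auto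
    moreover have "(2 * card I + 1) ^ dim U \<le> (2 * card (insert h I) + 1) ^ dim U"
      using insert.hyps by (intro power_mono) auto
    ultimately show ?thesis using F by linarith
  next
    case False
    have "H \<subseteq> U" by (auto simp: H_def)
    then have dimH: "dim H < dim U"
      using subspace_dim_equal[OF subH \<open>subspace U\<close>] False by force
    define Fp where "Fp = sign_vector f I ` {v \<in> U. f h v > 0}"
    define Fn where "Fn = sign_vector f I ` {v \<in> U. f h v < 0}"
    have "Fp \<inter> Fn \<subseteq> F0"
    proof
      fix t assume "t \<in> Fp \<inter> Fn"
      then obtain u v where u: "u \<in> U" "f h u > 0" "t = sign_vector f I u"
        and v: "v \<in> U" "f h v < 0" "t = sign_vector f I v" by (auto simp: Fp_def Fn_def)
      define w where "w = (- f h v) *\<^sub>R u + f h u *\<^sub>R v"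
      have "w \<in> H" using u v lin \<open>subspace U\<close>
        by (auto simp: H_def w_def linear_add linear_scale linear_diff subspace_def
            simp flip: scaleR_minus_left)
      moreover have "sign_vector f I w = t"
      proof
        fix i
        show "sign_vector f I w i = t i"
        proof (cases "i \<in> I")
          case True
          have "sgn (f i u) = sgn (f i v)" using u v sign_vector_eqD[OF _ True] by metis
          then have "sgn ((- f h v) * f i u + f h u * f i v) = sgn (f i u)"
            using u v by (intro sgn_pos_combination) auto
          moreover have "f i w = (- f h v) * f i u + f h u * f i v"
            unfolding w_def using linI[OF True] by (simp only: linear_add linear_scale) simp
          ultimately show ?thesis using True u by (simp add: sign_vector_def)
        qed (simp add: sign_vector_def u)
      qed
      ultimately show "t \<in> F0" by (auto simp: F0_def)
    qed
    then have int: "card (Fp \<inter> Fn) \<le> card F0" by (intro card_mono F0)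
    have un: "Fp \<union> Fn \<subseteq> F" by (auto simp: Fp_def Fn_def F_def)
    then have fin: "finite Fp" "finite Fn" using F(1) finite_subset by auto
    have "card Fp + card Fn = card (Fp \<union> Fn) + card (Fp \<inter> Fn)" by (rule card_Un_Int[OF fin])
    also have "\<dots> \<le> card F + card F0" using int card_mono[OF F(1) un] by linarith
    finally have pn: "card Fp + card Fn \<le> card F + card F0" .
    let ?G = "(\<lambda>t. t(h := 1)) ` Fp \<union> (\<lambda>t. t(h := -1)) ` Fn \<union> (\<lambda>t. t(h := 0)) ` F0"
    have sub: "sign_vector f (insert h I) ` U \<subseteq> ?G"
    proof
      fix t assume "t \<in> sign_vector f (insert h I) ` U"
      then obtain v where "v \<in> U" "t = sign_vector f (insert h I) v" by auto
      then show "t \<in> ?G"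
        by (cases "f h v" "0::real" rule: linorder_cases)
          (auto simp: sign_vector_insert Fp_def Fn_def F0_def H_def)
    qed
    have finG: "finite ?G" using fin F0 by auto
    have "card ?G \<le> card Fp + card Fn + card F0"
      by (intro order_trans[OF card_Un_le] add_mono card_image_le fin F0)
    also have "\<dots> \<le> card F + 2 * card F0" using pn by linarith
    also have "\<dots> \<le> (2 * card I + 1) ^ dim U + 2 * (2 * card I + 1) ^ dim H"
      using F F0 by linarith
    also have "\<dots> \<le> (2 * card I + 1) ^ dim U + 2 * (2 * card I + 1) ^ (dim U - 1)"
      using dimH by (intro add_left_mono mult_left_mono power_increasing) auto
    also have "\<dots> = (2 * card I + 3) * (2 * card I + 1) ^ (dim U - 1)"
      using dimH by (cases "dim U") (auto simp: algebra_simps)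
    also have "\<dots> \<le> (2 * card I + 3) * (2 * card I + 3) ^ (dim U - 1)"
      by (intro mult_left_mono power_mono) auto
    also have "\<dots> = (2 * card I + 3) ^ dim U"
      using dimH by (metis gr_implies_not_zero neq0_conv power_eq_if)
    also have "2 * card I + 3 = 2 * card (insert h I) + 1" using insert.hyps by simp
    finally show ?thesis
      using finite_subset[OF sub finG] card_mono[OF finG sub] by linarith
  qed
qed

section \<open>Optimality conditions for the assignment problem\<close>

text \<open>
  Finiteness of \<open>A\<close> makes the generated cone closed, so that a point outside of it can be separated
  strictly.
\<close>

lemma Farkas_convex_cone_hull:
  fixes A :: "'a::euclidean_space set"
  assumes "finite A" and dual: "\<And>v. (\<And>a. a \<in> A \<Longrightarrow> 0 \<le> a \<bullet> v) \<Longrightarrow> 0 \<le> c \<bullet> v"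
  shows "c \<in> convex_cone hull A"
proof (rule ccontr)
  assume "c \<notin> convex_cone hull A"
  moreover have "closed (convex_cone hull A)"
    using assms(1) by (intro polyhedron_imp_closed polyhedron_convex_cone_hull)
  ultimately obtain v b where c: "v \<bullet> c < b" and sep: "\<And>a. a \<in> convex_cone hull A \<Longrightarrow> v \<bullet> a > b"
    using separating_hyperplane_closed_point[OF convex_convex_cone_hull] by blast
  have b: "b < 0" using sep[OF convex_cone_hull_contains_0] by simp
  have "0 \<le> a \<bullet> v" if "a \<in> A" for a
  proof (rule ccontr)
    assume neg: "\<not> 0 \<le> a \<bullet> v"
    then have "0 \<le> b / (a \<bullet> v)" using b by (simp add: divide_nonpos_neg)
    then have "v \<bullet> ((b / (a \<bullet> v)) *\<^sub>R a) > b"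
      by (intro sep convex_cone_hull_mul hull_inc that)
    then show False using neg by (simp add: inner_commute)
  qed
  then have "0 \<le> c \<bullet> v" by (rule dual)
  then show False using b c by (simp add: inner_commute)
qed

lemma eventually_at_right_affine_nonneg:
  fixes p q :: real
  assumes "0 \<le> p" "p = 0 \<Longrightarrow> 0 \<le> q"
  shows "\<forall>\<^sub>F t in at_right 0. 0 \<le> p + t * q"
proof (cases "p = 0")
  case True
  have "\<forall>\<^sub>F t in at_right (0::real). 0 < t" by (rule eventually_at_right_less)
  then show ?thesis using True assms by (auto elim!: eventually_mono)
next
  case False
  have "((\<lambda>t. p + t * q) \<longlongrightarrow> p + 0 * q) (at_right 0)" by (intro tendsto_intros)
  then have "\<forall>\<^sub>F t in at_right 0. 0 < p + t * q"
    using order_tendstoD(1)[of _ p "at_right 0" 0] False assms by auto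
  then show ?thesis by (auto elim!: eventually_mono)
qed

text \<open>The squared distance of \<open>x j\<close> and \<open>s i\<close> without the term \<open>x j \<bullet> x j\<close>, which does not depend on i.\<close>

definition site_cost :: "('n \<Rightarrow> real ^ 'd) \<Rightarrow> ('k \<Rightarrow> real ^ 'd) \<Rightarrow> 'k \<Rightarrow> 'n \<Rightarrow> real" where
  "site_cost x s i j = s i \<bullet> s i - 2 * (x j \<bullet> s i)"

text \<open>
  The Karush-Kuhn-Tucker conditions of the assignment problem, where \<open>\<mu> i\<close> is the difference of the
  multipliers of the lower and the upper bound for the size of cluster i, and the multipliers of the
  points have been eliminated.
\<close>

definition cluster_multipliers ::
  "('n::finite \<Rightarrow> real ^ 'd) \<Rightarrow> ('n \<Rightarrow> real) \<Rightarrow> ('k::finite \<Rightarrow> real) \<Rightarrow> ('k \<Rightarrow> real) \<Rightarrow>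
   ('k \<Rightarrow> real ^ 'd) \<Rightarrow> real ^ 'n ^ 'k \<Rightarrow> ('k \<Rightarrow> real) \<Rightarrow> bool"
where
  "cluster_multipliers x \<omega> \<kappa>m \<kappa>p s y \<mu> \<longleftrightarrow>
     (\<forall>i. (\<mu> i > 0 \<longrightarrow> cluster_size \<omega> y i = \<kappa>m i) \<and> (\<mu> i < 0 \<longrightarrow> cluster_size \<omega> y i = \<kappa>p i)) \<and>
     (\<forall>i j l. y $ i $ j > 0 \<longrightarrow> site_cost x s i j - \<mu> i \<le> site_cost x s l j - \<mu> l)"

lemma cluster_size_add_scaleR:
  "cluster_size \<omega> (y + t *\<^sub>R v) i = cluster_size \<omega> y i + t * cluster_size \<omega> v i"
  by (simp add: cluster_size_def algebra_simps sum.distrib sum_distrib_left)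

lemma objective_add_scaleR:
  "objective x \<omega> (y + t *\<^sub>R v) s = objective x \<omega> y s + t * objective x \<omega> v s"
  by (simp add: objective_def algebra_simps sum.distrib sum_distrib_left sum_subtractf)

lemma objective_site_cost:
  "objective x \<omega> y s = (\<Sum>i\<in>UNIV. \<Sum>j\<in>UNIV. y $ i $ j * \<omega> j * site_cost x s i j)"
  by (simp add: objective_def site_cost_def)

text \<open>
  Weak duality: after subtraction of the multipliers, \<open>y\<close> assigns every point at minimal cost, and the
  subtracted amount is largest possible for \<open>y\<close> by the conditions on the cluster sizes.
\<close>

lemma optimal_if_cluster_multipliers:
  assumes \<omega>: "\<And>j. 0 \<le> \<omega> j"
    and y: "y \<in> feasible_polytope \<omega> \<kappa>m \<kappa>p" and z: "z \<in> feasible_polytope \<omega> \<kappa>m \<kappa>p"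
    and mult: "cluster_multipliers x \<omega> \<kappa>m \<kappa>p s y \<mu>"
  shows "objective x \<omega> y s \<le> objective x \<omega> z s"
proof -
  define r where "r i j = site_cost x s i j - \<mu> i" for i j
  have split: "objective x \<omega> u s =
      (\<Sum>j\<in>UNIV. \<omega> j * (\<Sum>i\<in>UNIV. u $ i $ j * r i j)) + (\<Sum>i\<in>UNIV. \<mu> i * cluster_size \<omega> u i)" for u
  proof -
    have "objective x \<omega> u s =
        (\<Sum>i\<in>UNIV. \<Sum>j\<in>UNIV. u $ i $ j * \<omega> j * r i j) + (\<Sum>i\<in>UNIV. \<mu> i * cluster_size \<omega> u i)"
      by (simp add: objective_site_cost r_def cluster_size_def sum_distrib_left algebra_simps
          flip: sum.distrib)
    moreover have "(\<Sum>i\<in>UNIV. \<Sum>j\<in>UNIV. u $ i $ j * \<omega> j * r i j) =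
        (\<Sum>j\<in>UNIV. \<omega> j * (\<Sum>i\<in>UNIV. u $ i $ j * r i j))"
      by (subst sum.swap) (simp add: sum_distrib_left algebra_simps)
    ultimately show ?thesis by simp
  qed
  have assign: "(\<Sum>i\<in>UNIV. y $ i $ j * r i j) \<le> (\<Sum>i\<in>UNIV. z $ i $ j * r i j)" for j
  proof -
    define m where "m = Min (range (\<lambda>i. r i j))"
    have at_min: "y $ i $ j * r i j = y $ i $ j * m" for i
    proof (cases "y $ i $ j = 0")
      case False
      then have "y $ i $ j > 0" using y by (simp add: feasible_polytope_def order_less_le)
      then have "r i j \<le> r l j" for l using mult by (simp add: cluster_multipliers_def r_def)
      then have "m = r i j" unfolding m_def by (intro Min_eqI) auto
      then show ?thesis by simp
    qed simp
    have "(\<Sum>i\<in>UNIV. y $ i $ j * r i j) = m"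
      unfolding at_min using y by (simp add: feasible_polytope_def flip: sum_distrib_right)
    also have "m = (\<Sum>i\<in>UNIV. z $ i $ j * m)"
      using z by (simp add: feasible_polytope_def flip: sum_distrib_right)
    also have "\<dots> \<le> (\<Sum>i\<in>UNIV. z $ i $ j * r i j)"
      using z by (intro sum_mono mult_left_mono) (auto simp: feasible_polytope_def m_def)
    finally show ?thesis .
  qed
  have size: "\<mu> i * cluster_size \<omega> y i \<le> \<mu> i * cluster_size \<omega> z i" for i
  proof (cases "\<mu> i" "0::real" rule: linorder_cases)
    case less
    then have "cluster_size \<omega> z i \<le> cluster_size \<omega> y i"
      using mult z by (simp add: cluster_multipliers_def feasible_polytope_def)
    then show ?thesis using less by (simp add: mult_left_mono_neg)
  next
    case greater
    then have "cluster_size \<omega> y i \<le> cluster_size \<omega> z i"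
      using mult z by (simp add: cluster_multipliers_def feasible_polytope_def)
    then show ?thesis using greater by (simp add: mult_left_mono)
  qed simp
  show ?thesis
    unfolding split by (intro add_mono sum_mono mult_left_mono assign size \<omega>)
qed

text \<open>
  Strong duality.  A direction \<open>v\<close> that violates none of the constraints that are tight at \<open>y\<close> stays in
  the polytope for a short while, so the objective cannot decrease along \<open>v\<close>.  By the lemma of Farkas,
  the objective is then a nonnegative combination of the normals of the tight constraints; the
  coefficients of the size constraints are the multipliers.
\<close>

lemma cluster_multipliers_if_optimal:
  fixes y :: "real ^ 'n::finite ^ 'k::finite"
  assumes \<omega>: "\<And>j. 0 < \<omega> j"
    and y: "y \<in> feasible_polytope \<omega> \<kappa>m \<kappa>p"
    and opt: "\<And>z. z \<in> feasible_polytope \<omega> \<kappa>m \<kappa>p \<Longrightarrow> objective x \<omega> y s \<le> objective x \<omega> z s"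
  shows "\<exists>\<mu>. cluster_multipliers x \<omega> \<kappa>m \<kappa>p s y \<mu>"
proof -
  define col :: "'n \<Rightarrow> real ^ 'n ^ 'k" where "col j = (\<chi> i j'. if j' = j then 1 else 0)" for j
  define ent :: "'k \<Rightarrow> 'n \<Rightarrow> real ^ 'n ^ 'k" where "ent i j = axis i (axis j 1)" for i j
  define row :: "'k \<Rightarrow> real ^ 'n ^ 'k" where "row i = axis i (\<chi> j. \<omega> j)" for i
  define c :: "real ^ 'n ^ 'k" where "c = (\<chi> i j. \<omega> j * site_cost x s i j)"
  define A where "A = range col \<union> uminus ` range col \<union> {ent i j |i j. y $ i $ j = 0} \<union>
    row ` {i. cluster_size \<omega> y i = \<kappa>m i} \<union> (\<lambda>i. - row i) ` {i. cluster_size \<omega> y i = \<kappa>p i}"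
  have "{ent i j |i j. y $ i $ j = 0} \<subseteq> (\<lambda>(i, j). ent i j) ` UNIV" by auto
  then have "finite {ent i j |i j. y $ i $ j = 0}" by (rule finite_subset) simp
  then have finA: "finite A" by (simp add: A_def)
  have inner_col: "col j \<bullet> v = (\<Sum>i\<in>UNIV. v $ i $ j)" for j v
    by (simp add: col_def inner_vec_def if_distrib[where f = "\<lambda>a. a * _"] cong: if_cong)
  have inner_ent: "ent i j \<bullet> v = v $ i $ j" for i j v
    by (simp add: ent_def inner_axis')
  have inner_row: "row i \<bullet> v = cluster_size \<omega> v i" for i v
  proof -
    have "row i \<bullet> v = (\<chi> j. \<omega> j) \<bullet> v $ i" by (simp add: row_def inner_axis')
    then show ?thesis by (simp add: cluster_size_def inner_vec_def mult.commute)
  qed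
  have inner_c: "c \<bullet> v = objective x \<omega> v s" for v
    by (simp add: c_def objective_site_cost inner_vec_def algebra_simps)
  have "0 \<le> c \<bullet> v" if v: "\<And>a. a \<in> A \<Longrightarrow> 0 \<le> a \<bullet> v" for v
  proof -
    have v_col: "(\<Sum>i\<in>UNIV. v $ i $ j) = 0" for j
      using v[of "col j"] v[of "- col j"] by (simp add: A_def inner_col)
    have v_ent: "0 \<le> v $ i $ j" if "y $ i $ j = 0" for i j
      using v[of "ent i j"] that by (auto simp: A_def inner_ent)
    have v_min: "0 \<le> cluster_size \<omega> v i" if "cluster_size \<omega> y i = \<kappa>m i" for i
      using v[of "row i"] that by (simp add: A_def inner_row)
    have v_max: "0 \<le> - cluster_size \<omega> v i" if "cluster_size \<omega> y i = \<kappa>p i" for i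
      using v[of "- row i"] that by (simp add: A_def inner_row)
    have "\<forall>\<^sub>F t in at_right 0. \<forall>i j. 0 \<le> y $ i $ j + t * v $ i $ j"
      using y v_ent by (intro eventually_all_finite eventually_at_right_affine_nonneg)
        (auto simp: feasible_polytope_def)
    moreover have "\<forall>\<^sub>F t in at_right 0. \<forall>i. 0 \<le> (cluster_size \<omega> y i - \<kappa>m i) + t * cluster_size \<omega> v i"
      using y v_min by (intro eventually_all_finite eventually_at_right_affine_nonneg)
        (auto simp: feasible_polytope_def)
    moreover have
      "\<forall>\<^sub>F t in at_right 0. \<forall>i. 0 \<le> (\<kappa>p i - cluster_size \<omega> y i) + t * - cluster_size \<omega> v i"
      using y v_max by (intro eventually_all_finite eventually_at_right_affine_nonneg)
        (auto simp: feasible_polytope_def)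
    moreover have "\<forall>\<^sub>F t in at_right (0::real). 0 < t" by (rule eventually_at_right_less)
    ultimately have "\<forall>\<^sub>F t in at_right 0. 0 < t \<and> y + t *\<^sub>R v \<in> feasible_polytope \<omega> \<kappa>m \<kappa>p"
    proof eventually_elim
      case (elim t)
      have "(\<Sum>i\<in>UNIV. (y + t *\<^sub>R v) $ i $ j) = 1" for j
        using y v_col by (simp add: sum.distrib feasible_polytope_def flip: sum_distrib_left)
      then show ?case using elim
        by (simp add: feasible_polytope_def cluster_size_add_scaleR algebra_simps)
    qed
    then obtain t where t: "0 < t" "y + t *\<^sub>R v \<in> feasible_polytope \<omega> \<kappa>m \<kappa>p"
      using eventually_happens trivial_limit_at_right_real by blast
    have "0 \<le> t * objective x \<omega> v s"
      using opt[OF t(2)] by (simp add: objective_add_scaleR)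
    then show ?thesis using t by (simp add: inner_c zero_le_mult_iff)
  qed
  then have c_hull: "c \<in> convex_cone hull A" by (rule Farkas_convex_cone_hull[OF finA])
  \<comment> \<open>The coefficients belong to the points (\<open>\<eta>\<close>), the tight constraints \<open>y $ i $ j \<ge> 0\<close> (\<open>\<nu>\<close>) and the
    tight size constraints (\<open>\<mu>\<close>).  The sign of \<open>\<mu> i\<close> is free if both bounds are tight.\<close>
  define adm where "adm \<nu> \<mu> \<longleftrightarrow>
    (\<forall>i j. 0 \<le> \<nu> i j \<and> (0 < y $ i $ j \<longrightarrow> \<nu> i j = 0)) \<and>
    (\<forall>i. (\<mu> i > 0 \<longrightarrow> cluster_size \<omega> y i = \<kappa>m i) \<and> (\<mu> i < 0 \<longrightarrow> cluster_size \<omega> y i = \<kappa>p i))"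
    for \<nu> :: "'k \<Rightarrow> 'n \<Rightarrow> real" and \<mu> :: "'k \<Rightarrow> real"
  define comb :: "('n \<Rightarrow> real) \<Rightarrow> ('k \<Rightarrow> 'n \<Rightarrow> real) \<Rightarrow> ('k \<Rightarrow> real) \<Rightarrow> real ^ 'n ^ 'k"
    where "comb \<eta> \<nu> \<mu> = (\<chi> i j. \<eta> j + \<nu> i j + \<mu> i * \<omega> j)" for \<eta> \<nu> \<mu>
  define W where "W = {comb \<eta> \<nu> \<mu> |\<eta> \<nu> \<mu>. adm \<nu> \<mu>}"
  have WI: "w \<in> W" if "w = comb \<eta> \<nu> \<mu>" "adm \<nu> \<mu>" for w \<eta> \<nu> \<mu>
    using that by (auto simp: W_def)
  have "convex_cone W"
    unfolding convex_cone_iff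
  proof (intro conjI ballI allI impI)
    show "0 \<in> W"
      by (rule WI[of _ "\<lambda>_. 0" "\<lambda>_ _. 0" "\<lambda>_. 0"]) (auto simp: comb_def adm_def vec_eq_iff)
  next
    fix u w assume "u \<in> W" "w \<in> W"
    then obtain \<eta> \<nu> \<mu> \<eta>' \<nu>' \<mu>'
      where *: "u = comb \<eta> \<nu> \<mu>" "adm \<nu> \<mu>" "w = comb \<eta>' \<nu>' \<mu>'" "adm \<nu>' \<mu>'"
      by (auto simp: W_def)
    have "cluster_size \<omega> y i = \<kappa>m i" if "\<mu> i + \<mu>' i > 0" for i
    proof -
      have "\<mu> i > 0 \<or> \<mu>' i > 0" using that by linarith
      then show ?thesis using * by (auto simp: adm_def)
    qed
    moreover have "cluster_size \<omega> y i = \<kappa>p i" if "\<mu> i + \<mu>' i < 0" for i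
    proof -
      have "\<mu> i < 0 \<or> \<mu>' i < 0" using that by linarith
      then show ?thesis using * by (auto simp: adm_def)
    qed
    ultimately have "adm (\<lambda>i j. \<nu> i j + \<nu>' i j) (\<lambda>i. \<mu> i + \<mu>' i)"
      using * by (auto simp: adm_def)
    moreover have "u + w = comb (\<lambda>j. \<eta> j + \<eta>' j) (\<lambda>i j. \<nu> i j + \<nu>' i j) (\<lambda>i. \<mu> i + \<mu>' i)"
      using * by (simp add: comb_def vec_eq_iff algebra_simps)
    ultimately show "u + w \<in> W" by (intro WI)
  next
    fix u and a :: real assume "u \<in> W" "0 \<le> a"
    then obtain \<eta> \<nu> \<mu> where *: "u = comb \<eta> \<nu> \<mu>" "adm \<nu> \<mu>" by (auto simp: W_def)
    have "adm (\<lambda>i j. a * \<nu> i j) (\<lambda>i. a * \<mu> i)"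
      using * \<open>0 \<le> a\<close> by (auto simp: adm_def zero_less_mult_iff mult_less_0_iff)
    moreover have "a *\<^sub>R u = comb (\<lambda>j. a * \<eta> j) (\<lambda>i j. a * \<nu> i j) (\<lambda>i. a * \<mu> i)"
      using * by (simp add: comb_def vec_eq_iff algebra_simps)
    ultimately show "a *\<^sub>R u \<in> W" by (intro WI)
  qed
  moreover have "A \<subseteq> W"
  proof -
    have "col j \<in> W" for j
      by (rule WI[of _ "\<lambda>j'. if j' = j then 1 else 0" "\<lambda>_ _. 0" "\<lambda>_. 0"])
        (auto simp: comb_def adm_def vec_eq_iff col_def)
    moreover have "- col j \<in> W" for j
      by (rule WI[of _ "\<lambda>j'. if j' = j then - 1 else 0" "\<lambda>_ _. 0" "\<lambda>_. 0"])
        (auto simp: comb_def adm_def vec_eq_iff col_def)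
    moreover have "ent i j \<in> W" if "y $ i $ j = 0" for i j
      by (rule WI[of _ "\<lambda>_. 0" "\<lambda>i' j'. if i' = i \<and> j' = j then 1 else 0" "\<lambda>_. 0"])
        (use that in \<open>auto simp: comb_def adm_def vec_eq_iff ent_def axis_def\<close>)
    moreover have "row i \<in> W" if "cluster_size \<omega> y i = \<kappa>m i" for i
      by (rule WI[of _ "\<lambda>_. 0" "\<lambda>_ _. 0" "\<lambda>i'. if i' = i then 1 else 0"])
        (use that in \<open>auto simp: comb_def adm_def vec_eq_iff row_def axis_def\<close>)
    moreover have "- row i \<in> W" if "cluster_size \<omega> y i = \<kappa>p i" for i
      by (rule WI[of _ "\<lambda>_. 0" "\<lambda>_ _. 0" "\<lambda>i'. if i' = i then - 1 else 0"])
        (use that in \<open>auto simp: comb_def adm_def vec_eq_iff row_def axis_def\<close>)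
    ultimately show ?thesis by (auto simp: A_def)
  qed
  ultimately have "convex_cone hull A \<subseteq> W" by (intro hull_minimal)
  then have "c \<in> W" using c_hull by blast
  then obtain \<eta> \<nu> \<mu> where c: "c = comb \<eta> \<nu> \<mu>" and adm: "adm \<nu> \<mu>" by (auto simp: W_def)
  have "site_cost x s i j - \<mu> i \<le> site_cost x s l j - \<mu> l" if "y $ i $ j > 0" for i j l
  proof -
    have eq: "\<omega> j * (site_cost x s i' j - \<mu> i') = \<eta> j + \<nu> i' j" for i'
    proof -
      have "c $ i' $ j = comb \<eta> \<nu> \<mu> $ i' $ j" using c by simp
      then show ?thesis by (simp add: c_def comb_def algebra_simps)
    qed
    have "\<omega> j * (site_cost x s i j - \<mu> i) \<le> \<omega> j * (site_cost x s l j - \<mu> l)"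
      unfolding eq using adm that by (simp add: adm_def)
    then show ?thesis using \<omega>[of j] by (simp add: mult_le_cancel_left_pos)
  qed
  then have "cluster_multipliers x \<omega> \<kappa>m \<kappa>p s y \<mu>"
    using adm by (simp add: cluster_multipliers_def adm_def)
  then show ?thesis by blast
qed

lemma cluster_multipliers_cong:
  assumes "cluster_multipliers x \<omega> \<kappa>m \<kappa>p s y \<mu>"
    and "\<And>i. sgn (\<mu> i) = sgn (\<mu>' i)"
    and "\<And>i j l. sgn ((site_cost x s i j - \<mu> i) - (site_cost x s l j - \<mu> l)) =
      sgn ((site_cost x s' i j - \<mu>' i) - (site_cost x s' l j - \<mu>' l))"
  shows "cluster_multipliers x \<omega> \<kappa>m \<kappa>p s' y \<mu>'"
proof -
  have "\<mu> i > 0 \<longleftrightarrow> \<mu>' i > 0" "\<mu> i < 0 \<longleftrightarrow> \<mu>' i < 0" for i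
    using assms(2)[of i] by (metis sgn_greater, metis sgn_less)
  moreover have "site_cost x s i j - \<mu> i \<le> site_cost x s l j - \<mu> l \<longleftrightarrow>
      site_cost x s' i j - \<mu>' i \<le> site_cost x s' l j - \<mu>' l" for i j l
    using assms(3)[of i j l] by (metis diff_le_0_iff_le not_less sgn_greater)
  ultimately show ?thesis using assms(1) unfolding cluster_multipliers_def by simp
qed

section \<open>The number of signatures\<close>

text \<open>
  A vector \<open>v\<close> encodes the sites \<open>s i = fst (v $ i)\<close> together with the numbers
  \<open>snd (v $ i) = s i \<bullet> s i - \<mu> i\<close>, so that the value is
  \<open>(site_cost x s i j - \<mu> i) - (site_cost x s l j - \<mu> l)\<close>.
\<close>

definition diagram_form ::
  "('n \<Rightarrow> real ^ 'd) \<Rightarrow> 'n \<times> 'k \<times> 'k \<Rightarrow> ((real ^ 'd) \<times> real) ^ 'k \<Rightarrow> real"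
where
  "diagram_form x = (\<lambda>(j, i, l) v.
     (snd (v $ i) - 2 * (x j \<bullet> fst (v $ i))) - (snd (v $ l) - 2 * (x j \<bullet> fst (v $ l))))"

lemma linear_diagram_form: "linear (diagram_form x h)"
proof (rule linearI)
  obtain j i l where "h = (j, i, l)" by (metis prod_cases3)
  then show "diagram_form x h (u + v) = diagram_form x h u + diagram_form x h v"
    "diagram_form x h (c *\<^sub>R v) = c *\<^sub>R diagram_form x h v" for u v c
    by (simp_all add: diagram_form_def inner_add_right right_diff_distrib)
qed

lemma card_diagram_sign_vectors_le:
  fixes x :: "'n::finite \<Rightarrow> real ^ 'd::finite"
  defines "signs \<equiv> range (sign_vector (diagram_form x) (UNIV :: ('n \<times> 'k::finite \<times> 'k) set))"
  shows "finite signs \<and>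
    card signs \<le> (2 * (CARD('n) * CARD('k) ^ 2) + 1) ^ ((CARD('d) + 1) * CARD('k) - 1)"
proof -
  fix i0 :: 'k
  \<comment> \<open>The hyperplane \<open>snd (v $ i0) = 0\<close> has the normal vector \<open>e\<close>.  Adding one constant to all
    \<open>snd (v $ i)\<close> moves any vector into it and changes no value of the forms.\<close>
  define e :: "((real ^ 'd) \<times> real) ^ 'k" where "e = axis i0 (0, 1)"
  define U where "U = {v :: ((real ^ 'd) \<times> real) ^ 'k. e \<bullet> v = 0}"
  have inner_e: "e \<bullet> v = snd (v $ i0)" for v by (simp add: e_def inner_axis' inner_prod_def)
  have "e \<noteq> 0" by (simp add: e_def axis_eq_0_iff zero_prod_def)
  then have dimU: "dim U = (CARD('d) + 1) * CARD('k) - 1"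
    unfolding U_def by (subst dim_hyperplane) (simp_all add: algebra_simps)
  have "sign_vector (diagram_form x) UNIV v \<in> sign_vector (diagram_form x) UNIV ` U"
    for v :: "((real ^ 'd) \<times> real) ^ 'k"
  proof (rule image_eqI)
    define w where "w = (\<chi> i. (fst (v $ i), snd (v $ i) - snd (v $ i0)))"
    show "sign_vector (diagram_form x) UNIV v = sign_vector (diagram_form x) UNIV w"
    proof -
      have "diagram_form x h v = diagram_form x h w" for h
        by (cases h) (simp add: diagram_form_def w_def)
      then show ?thesis by (simp add: sign_vector_def)
    qed
    show "w \<in> U" by (simp add: U_def inner_e w_def)
  qed
  then have signs: "signs = sign_vector (diagram_form x) UNIV ` U" by (auto simp: signs_def)
  have "subspace U" unfolding U_def by (rule subspace_hyperplane)
  then show ?thesis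
    using card_sign_vectors_le[of "UNIV :: ('n \<times> 'k \<times> 'k) set" "diagram_form x" U]
    by (simp add: signs dimU linear_diagram_form power2_eq_square)
qed

definition signature ::
  "('n::finite \<Rightarrow> real ^ 'd::finite) \<Rightarrow> ('k::finite \<Rightarrow> real ^ 'd) \<Rightarrow> ('k \<Rightarrow> real) \<Rightarrow>
   ('n \<times> 'k \<times> 'k \<Rightarrow> real) \<times> ('k \<Rightarrow> real)"
where
  "signature x s \<mu> =
     (sign_vector (diagram_form x) UNIV (\<chi> i. (s i, s i \<bullet> s i - \<mu> i)), \<lambda>i. sgn (\<mu> i))"

lemma signature_eqD:
  assumes "signature x s \<mu> = signature x s' \<mu>'"
  shows "sgn (\<mu> i) = sgn (\<mu>' i)"
    and "sgn ((site_cost x s i j - \<mu> i) - (site_cost x s l j - \<mu> l)) =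
      sgn ((site_cost x s' i j - \<mu>' i) - (site_cost x s' l j - \<mu>' l))"
proof -
  show "sgn (\<mu> i) = sgn (\<mu>' i)" using assms by (simp add: signature_def fun_eq_iff)
  have "sgn (diagram_form x (j, i, l) (\<chi> i. (s i, s i \<bullet> s i - \<mu> i))) =
      sgn (diagram_form x (j, i, l) (\<chi> i. (s' i, s' i \<bullet> s' i - \<mu>' i)))"
    using assms by (auto simp: signature_def intro: sign_vector_eqD)
  then show "sgn ((site_cost x s i j - \<mu> i) - (site_cost x s l j - \<mu> l)) =
      sgn ((site_cost x s' i j - \<mu>' i) - (site_cost x s' l j - \<mu>' l))"
    by (simp add: diagram_form_def site_cost_def algebra_simps)
qed

lemma card_signatures_le:
  fixes x :: "'n::finite \<Rightarrow> real ^ 'd::finite"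
  defines "sigs \<equiv> range (\<lambda>(s :: 'k::finite \<Rightarrow> real ^ 'd, \<mu>). signature x s \<mu>)"
  shows "finite sigs \<and>
    card sigs \<le> (2 * (CARD('n) * CARD('k) ^ 2) + 1) ^ ((CARD('d) + 1) * CARD('k) - 1) * 3 ^ CARD('k)"
proof -
  let ?D = "range (sign_vector (diagram_form x) (UNIV :: ('n \<times> 'k \<times> 'k) set))"
  let ?M = "PiE (UNIV :: 'k set) (\<lambda>_. {-1, 0, 1 :: real})"
  have D: "finite ?D"
    "card ?D \<le> (2 * (CARD('n) * CARD('k) ^ 2) + 1) ^ ((CARD('d) + 1) * CARD('k) - 1)"
    using card_diagram_sign_vectors_le by blast+
  have M: "finite ?M" "card ?M = 3 ^ CARD('k)"
    by (auto simp: card_PiE numeral_3_eq_3 intro: finite_PiE)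
  have "sgn a \<in> {-1, 0, 1}" for a :: real by (simp add: sgn_if)
  then have sub: "sigs \<subseteq> ?D \<times> ?M" by (auto simp: sigs_def signature_def PiE_def Pi_def)
  then have "finite sigs" using D M finite_subset by blast
  have "card sigs \<le> card (?D \<times> ?M)" using sub D M by (intro card_mono) auto
  also have "\<dots> = card ?D * 3 ^ CARD('k)" by (simp add: card_cartesian_product M(2))
  also have "\<dots> \<le> (2 * (CARD('n) * CARD('k) ^ 2) + 1) ^ ((CARD('d) + 1) * CARD('k) - 1) * 3 ^ CARD('k)"
    using D(2) by (rule mult_right_mono) simp
  finally show ?thesis using \<open>finite sigs\<close> by blast
qed

section \<open>The run of the algorithm\<close>

lemma objective_center_of_gravity_le:
  fixes y :: "real ^ 'n::finite ^ 'k::finite"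
  assumes "\<And>i. 0 < cluster_size \<omega> y i"
  shows "objective x \<omega> y (center_of_gravity x \<omega> y) \<le> objective x \<omega> y s"
proof -
  define c where "c = center_of_gravity x \<omega> y"
  \<comment> \<open>Completing the square shows that row i is minimal at \<open>c i\<close>.\<close>
  have row: "(\<Sum>j\<in>UNIV. y $ i $ j * \<omega> j * (p \<bullet> p - 2 * (x j \<bullet> p))) =
      cluster_size \<omega> y i * ((p - c i) \<bullet> (p - c i) - c i \<bullet> c i)" for i p
  proof -
    have "(\<Sum>j\<in>UNIV. (y $ i $ j * \<omega> j) *\<^sub>R x j) = cluster_size \<omega> y i *\<^sub>R c i"
      using assms[of i] by (simp add: c_def center_of_gravity_def)
    moreover have "(\<Sum>j\<in>UNIV. y $ i $ j * \<omega> j * (x j \<bullet> p)) =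
        (\<Sum>j\<in>UNIV. (y $ i $ j * \<omega> j) *\<^sub>R x j) \<bullet> p"
      by (simp add: inner_sum_left)
    ultimately have lin: "(\<Sum>j\<in>UNIV. y $ i $ j * \<omega> j * (x j \<bullet> p)) = cluster_size \<omega> y i * (c i \<bullet> p)"
      by simp
    have "(\<Sum>j\<in>UNIV. y $ i $ j * \<omega> j * (p \<bullet> p - 2 * (x j \<bullet> p))) =
        (\<Sum>j\<in>UNIV. y $ i $ j * \<omega> j * (p \<bullet> p) - 2 * (y $ i $ j * \<omega> j * (x j \<bullet> p)))"
      by (intro sum.cong refl) (simp add: right_diff_distrib)
    also have "\<dots> = cluster_size \<omega> y i * (p \<bullet> p) - 2 * (\<Sum>j\<in>UNIV. y $ i $ j * \<omega> j * (x j \<bullet> p))"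
      by (simp only: sum_subtractf cluster_size_def sum_distrib_left sum_distrib_right)
    also have "\<dots> = cluster_size \<omega> y i * ((p - c i) \<bullet> (p - c i) - c i \<bullet> c i)"
      unfolding lin by (simp add: inner_diff_left inner_diff_right inner_commute right_diff_distrib)
    finally show ?thesis .
  qed
  show ?thesis
    unfolding objective_def row c_def[symmetric]
    using assms by (intro sum_mono mult_left_mono) (auto simp: less_imp_le)
qed

text \<open>
  Iteration \<open>p + 1\<close> takes place only if the move of the sites to \<open>S (p + 1)\<close> decreased the objective of
  \<open>C p\<close>, and the optimal value for \<open>S (p + 1)\<close> is at most the decreased one.  Iteration \<open>p + 1\<close> may
  itself bring no decrease, so the last iteration is included.
\<close>

lemma kmeans_objective_less:
  assumes exec: "kmeans_execution x \<omega> \<kappa>m \<kappa>p S0 T C S" and "1 \<le> l" "l < m" "enat m \<le> T"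
  shows "objective x \<omega> (C m) (S m) < objective x \<omega> (C l) (S l)"
proof -
  have step: "objective x \<omega> (C (Suc p)) (S (Suc p)) < objective x \<omega> (C p) (S p)"
    if "1 \<le> p" "enat (Suc p) \<le> T" for p
  proof -
    have "enat p < T" using that(2) by (metis Suc_ile_eq)
    then have "C p \<in> feasible_polytope \<omega> \<kappa>m \<kappa>p"
      and less: "objective x \<omega> (C p) (S (Suc p)) < objective x \<omega> (C p) (S p)"
      using exec that
      by (auto simp: kmeans_execution_def basic_optimal_solution_def extreme_point_of_def)
    moreover have "basic_optimal_solution x \<omega> \<kappa>m \<kappa>p (S (Suc p)) (C (Suc p))"
      using exec that by (simp add: kmeans_execution_def)
    ultimately show ?thesis
      unfolding basic_optimal_solution_def by (blast intro: order.strict_trans1)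
  qed
  show ?thesis
    using \<open>l < m\<close> \<open>enat m \<le> T\<close>
  proof (induction m)
    case (Suc m)
    have "1 \<le> m \<or> l = m" using Suc.prems \<open>1 \<le> l\<close> by linarith
    then have less: "objective x \<omega> (C (Suc m)) (S (Suc m)) < objective x \<omega> (C m) (S m)"
      using step[of m] Suc.prems \<open>1 \<le> l\<close> by auto
    show ?case
    proof (cases "l = m")
      case False
      have "enat m \<le> T" using Suc.prems(2) by (meson Suc_ile_eq order_less_imp_le)
      then show ?thesis using Suc False less by simp
    qed (use less in simp)
  qed simp
qed

text \<open>
  The clustering \<open>C l\<close> may still be optimal for the sites \<open>S (l + 1)\<close>, so consecutive iterations have to
  be excluded.
\<close>

lemma not_optimal_for_later_sites:
  assumes inst: "kmeans_instance x \<omega> \<kappa>m \<kappa>p" and exec: "kmeans_execution x \<omega> \<kappa>m \<kappa>p S0 T C S"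
    and "1 \<le> l" "l + 2 \<le> m" "enat m \<le> T"
  shows "objective x \<omega> (C m) (S m) < objective x \<omega> (C l) (S m)"
proof -
  have run: "basic_optimal_solution x \<omega> \<kappa>m \<kappa>p (S p) (C p)"
    "S (p + 1) = center_of_gravity x \<omega> (C p)" if "1 \<le> p" "p \<le> m" for p
  proof -
    have "enat p \<le> T" using \<open>enat m \<le> T\<close> that(2) by (meson enat_ord_simps(1) order_trans)
    then show "basic_optimal_solution x \<omega> \<kappa>m \<kappa>p (S p) (C p)"
      "S (p + 1) = center_of_gravity x \<omega> (C p)"
      using exec that by (auto simp: kmeans_execution_def)
  qed
  have feas: "C l \<in> feasible_polytope \<omega> \<kappa>m \<kappa>p"
    using run(1)[of l] assms(3,4) by (simp add: basic_optimal_solution_def extreme_point_of_def)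
  have pos: "0 < cluster_size \<omega> (C l) i" for i
  proof -
    have "0 < \<kappa>m i" using inst by (simp add: kmeans_instance_def)
    also have "\<dots> \<le> cluster_size \<omega> (C l) i" using feas by (simp add: feasible_polytope_def)
    finally show ?thesis .
  qed
  have "objective x \<omega> (C m) (S m) < objective x \<omega> (C (l + 1)) (S (l + 1))"
    using assms by (intro kmeans_objective_less[OF exec]) auto
  also have "\<dots> \<le> objective x \<omega> (C l) (S (l + 1))"
    using run(1)[of "l + 1"] feas assms(4) by (simp add: basic_optimal_solution_def)
  also have "\<dots> \<le> objective x \<omega> (C l) (S m)"
    using objective_center_of_gravity_le[OF pos] run(2)[of l] assms(3,4) by simp
  finally show ?thesis .
qed

lemma kmeans_iterations_le:
  fixes x :: "'n::finite \<Rightarrow> real ^ 'd::finite" and \<kappa>m \<kappa>p :: "'k::finite \<Rightarrow> real"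
  assumes inst: "kmeans_instance x \<omega> \<kappa>m \<kappa>p" and exec: "kmeans_execution x \<omega> \<kappa>m \<kappa>p S0 T C S"
    and N: "enat N \<le> T"
  shows "N \<le> 2 * ((2 * (CARD('n) * CARD('k) ^ 2) + 1) ^ ((CARD('d) + 1) * CARD('k) - 1) * 3 ^ CARD('k))"
proof -
  have \<omega>: "0 < \<omega> j" for j using inst by (simp add: kmeans_instance_def)
  have run: "C l \<in> feasible_polytope \<omega> \<kappa>m \<kappa>p"
    "z \<in> feasible_polytope \<omega> \<kappa>m \<kappa>p \<Longrightarrow> objective x \<omega> (C l) (S l) \<le> objective x \<omega> z (S l)"
    if "1 \<le> l" "l \<le> N" for l z
  proof -
    have "enat l \<le> T" using N that(2) by (meson enat_ord_simps(1) order_trans)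
    then have "basic_optimal_solution x \<omega> \<kappa>m \<kappa>p (S l) (C l)"
      using exec that(1) by (simp add: kmeans_execution_def)
    then show "C l \<in> feasible_polytope \<omega> \<kappa>m \<kappa>p"
      "z \<in> feasible_polytope \<omega> \<kappa>m \<kappa>p \<Longrightarrow> objective x \<omega> (C l) (S l) \<le> objective x \<omega> z (S l)"
      by (auto simp: basic_optimal_solution_def extreme_point_of_def)
  qed
  have "\<exists>\<mu>. cluster_multipliers x \<omega> \<kappa>m \<kappa>p (S l) (C l) \<mu>" if "1 \<le> l" "l \<le> N" for l
    using run[OF that] by (intro cluster_multipliers_if_optimal \<omega>)
  then obtain M where M: "\<And>l. 1 \<le> l \<Longrightarrow> l \<le> N \<Longrightarrow> cluster_multipliers x \<omega> \<kappa>m \<kappa>p (S l) (C l) (M l)"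
    by metis
  define sig where "sig l = signature x (S l) (M l)" for l
  have sig_neq: "sig l \<noteq> sig m" if "1 \<le> l" "l + 2 \<le> m" "m \<le> N" for l m
  proof
    assume "sig l = sig m"
    then have eq: "signature x (S l) (M l) = signature x (S m) (M m)" by (simp only: sig_def)
    have "cluster_multipliers x \<omega> \<kappa>m \<kappa>p (S l) (C l) (M l)" using that by (intro M) auto
    then have "cluster_multipliers x \<omega> \<kappa>m \<kappa>p (S m) (C l) (M m)"
      using signature_eqD[OF eq] by (rule cluster_multipliers_cong)
    then have "objective x \<omega> (C l) (S m) \<le> objective x \<omega> (C m) (S m)"
      using optimal_if_cluster_multipliers[of \<omega> "C l" \<kappa>m \<kappa>p "C m"] run(1)[of l] run(1)[of m]
        \<omega> that by (simp add: less_imp_le)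
    moreover have "enat m \<le> T" using N that(3) by (meson enat_ord_simps(1) order_trans)
    ultimately show False
      using not_optimal_for_later_sites[OF inst exec that(1,2)] by simp
  qed
  \<comment> \<open>The iterations with odd index are not consecutive, and they are at least half of all.\<close>
  have "inj_on (\<lambda>q. sig (2 * q + 1)) {..<(N + 1) div 2}"
  proof (rule linorder_inj_onI')
    fix p q assume "p \<in> {..<(N + 1) div 2}" "q \<in> {..<(N + 1) div 2}" "p < q"
    then show "sig (2 * p + 1) \<noteq> sig (2 * q + 1)" by (intro sig_neq) auto
  qed
  then have "(N + 1) div 2 = card ((\<lambda>q. sig (2 * q + 1)) ` {..<(N + 1) div 2})"
    by (simp add: card_image)
  also have "\<dots> \<le> card (range (\<lambda>(s :: 'k \<Rightarrow> real ^ 'd, \<mu>). signature x s \<mu>))"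
  proof (rule card_mono)
    have "sig l \<in> range (\<lambda>(s :: 'k \<Rightarrow> real ^ 'd, \<mu>). signature x s \<mu>)" for l
      by (rule image_eqI[of _ _ "(S l, M l)"]) (simp_all add: sig_def)
    then show "(\<lambda>q. sig (2 * q + 1)) ` {..<(N + 1) div 2}
        \<subseteq> range (\<lambda>(s :: 'k \<Rightarrow> real ^ 'd, \<mu>). signature x s \<mu>)" by blast
  qed (use card_signatures_le[of x] in blast)
  also have "\<dots> \<le> (2 * (CARD('n) * CARD('k) ^ 2) + 1) ^ ((CARD('d) + 1) * CARD('k) - 1) * 3 ^ CARD('k)"
    using card_signatures_le[of x] by blast
  finally show ?thesis by linarith
qed

text \<open>
  The factor \<open>40 * exp 1 \<ge> 40\<close> leaves ample room: \<open>2 n k\<^sup>2 + 1 \<le> 3 n k\<^sup>2\<close>, and \<open>2 * 3 ^ k\<close> is absorbed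
  by the remaining factor, which is at least \<open>3 ^ ((d + 1) k - 1)\<close>.
\<close>

lemma signature_bound_le:
  fixes n k d :: nat
  assumes "2 \<le> k" "1 \<le> n" "1 \<le> d"
  shows "real (2 * ((2 * (n * k ^ 2) + 1) ^ ((d + 1) * k - 1) * 3 ^ k))
    \<le> (40 * exp 1 * (real k)\<^sup>2 * real n) ^ ((d + 1) * k - 1)"
proof -
  define E where "E = (d + 1) * k - 1"
  have "2 * k \<le> (d + 1) * k" using assms by (intro mult_right_mono) auto
  then have E: "k + 1 \<le> E" using assms unfolding E_def by linarith
  have "1 \<le> n * k ^ 2" using assms by (simp add: Suc_le_eq)
  then have "2 * (n * k ^ 2) + 1 \<le> 3 * (n * k ^ 2)" by linarith
  then have "2 * ((2 * (n * k ^ 2) + 1) ^ E * 3 ^ k) \<le> 3 * ((3 * (n * k ^ 2)) ^ E * 3 ^ k)"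
    by (intro mult_mono power_mono) auto
  also have "\<dots> = 3 ^ (k + 1) * (3 * (n * k ^ 2)) ^ E" by simp
  also have "\<dots> \<le> 3 ^ E * (3 * (n * k ^ 2)) ^ E"
    using E by (intro mult_right_mono power_increasing) auto
  also have "\<dots> = (3 * (3 * (n * k ^ 2))) ^ E" by (simp only: power_mult_distrib)
  also have "3 * (3 * (n * k ^ 2)) = 9 * (n * k ^ 2)" by simp
  finally have "real (2 * ((2 * (n * k ^ 2) + 1) ^ E * 3 ^ k)) \<le> real ((9 * (n * k ^ 2)) ^ E)"
    by (simp only: of_nat_le_iff)
  also have "\<dots> = (9 * ((real k)\<^sup>2 * real n)) ^ E" by (simp add: mult.commute)
  also have "\<dots> \<le> (40 * exp 1 * ((real k)\<^sup>2 * real n)) ^ E"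
  proof (intro power_mono mult_right_mono)
    show "9 \<le> 40 * exp (1::real)" using exp_ge_add_one_self[of 1] by linarith
  qed auto
  finally show ?thesis by (simp add: E_def mult.assoc)
qed

theorem theorem7:
  fixes x :: "'n::finite \<Rightarrow> real ^ 'd::finite"
    and \<omega> :: "'n \<Rightarrow> real"
    and \<kappa>m \<kappa>p :: "'k::finite \<Rightarrow> real"
    and S0 :: "'k \<Rightarrow> real ^ 'd"
    and T :: enat
    and C :: "nat \<Rightarrow> real ^ 'n ^ 'k"
    and S :: "nat \<Rightarrow> 'k \<Rightarrow> real ^ 'd"
  assumes "kmeans_instance x \<omega> \<kappa>m \<kappa>p"
    and "kmeans_execution x \<omega> \<kappa>m \<kappa>p S0 T C S"
    and "\<forall>l. 1 \<le> l \<and> enat l \<le> T + 1 \<longrightarrow> inj (S l)"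
  shows "\<exists>N. T = enat N \<and>
    real N \<le> (40 * exp 1 * (real CARD('k))\<^sup>2 * real CARD('n)) ^ ((CARD('d) + 1) * CARD('k) - 1)"
proof -
  let ?B = "2 * ((2 * (CARD('n) * CARD('k) ^ 2) + 1) ^ ((CARD('d) + 1) * CARD('k) - 1) * 3 ^ CARD('k))"
  have bound: "N \<le> ?B" if "enat N \<le> T" for N
    by (rule kmeans_iterations_le[OF assms(1,2) that])
  have "T \<noteq> \<infinity>"
  proof
    assume "T = \<infinity>"
    then have "?B + 1 \<le> ?B" by (intro bound) simp
    then show False by linarith
  qed
  then obtain N where N: "T = enat N" by (metis not_infinity_eq)
  have "2 \<le> CARD('k)" using assms(1) by (simp add: kmeans_instance_def)
  then have "real ?B \<le>
      (40 * exp 1 * (real CARD('k))\<^sup>2 * real CARD('n)) ^ ((CARD('d) + 1) * CARD('k) - 1)"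
    by (intro signature_bound_le) (simp_all add: Suc_le_eq)
  moreover have "real N \<le> real ?B" using bound[of N] N by (simp only: of_nat_le_iff order_refl)
  ultimately have "real N \<le>
      (40 * exp 1 * (real CARD('k))\<^sup>2 * real CARD('n)) ^ ((CARD('d) + 1) * CARD('k) - 1)"
    by (rule order_trans[rotated])
  then show ?thesis using N by blast
qed

end
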